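(* Let $\Sigma_n(P_1,P_0,\mathcal H,\widetilde W_B,\widetilde W_C)$ be a hyperbolic boundary control system satisfying the standing assumptions (1)–(5). Then its transfer function $\mathbf G$ is given for $s\in\rho(A)$ by $$\mathbf G(s)=\widetilde W_C\begin{bmatrix}\Psi_b^s\\\mathbb 1_n\end{bmatrix}\left(\widetilde W_B\begin{bmatrix}\Psi_b^s\\\mathbb 1_n\end{bmatrix}\right)^{-1}.$$
   Context: Let $\mathbb K\in\{\mathbb R,\mathbb C\}$, $a<b$, $n\ge1$, and let $\mathbb 1_n$ be the $n\times n$ identity matrix. **hBCS.** $\Sigma_n(P_1,P_0,\mathcal H,\widetilde W_B,\widetilde W_C)$ denotes the system on $[a,b]\times[0,\infty)$ with state $x(\xi,t)\in\mathbb K^n$, input $u(t)\in\mathbb K^n$, output $y(t)\in\mathbb K^n$: $$\tfrac{\partial x}{\partial t}(\xi,t)=P_1\tfrac{\partial}{\partial\xi}(\mathcal H(\xi)x(\xi,t))+P_0(\xi)\mathcal H(\xi)x(\xi,t),\quad x(\xi,0)=x_0(\xi),$$ $$u(t)=\widetilde W_B\begin{bmatrix}(\mathcal Hx)(b,t)\\(\mathcal Hx)(a,t)\end{bmatrix},\qquad y(t)=\widetilde W_C\begin{bmatrix}(\mathcal Hx)(b,t)\\(\mathcal Hx)(a,t)\end{bmatrix}.$$ **Standing assumptions.** (1) $P_1\in\mathbb K^{n\times n}$ is invertible and self-adjoint. (2) $P_0\in L^\infty([a,b],\mathbb K^{n\times n})$. (3) $\mathcal H\in L^\infty([a,b],\mathbb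 K^{n\times n})$, $\mathcal H(\xi)$ is self-adjoint and $m_0\mathbb 1_n\le\mathcal H(\xi)\le M_0\mathbb 1_n$ for a.e. $\xi$, for some constants $m_0,M_0>0$. (4) $\widetilde W_B\in\mathbb K^{n\times2n}$ and $\begin{bmatrix}\widetilde W_B\\\widetilde W_C\end{bmatrix}\in\mathbb K^{2n\times2n}$ have full rank. (5) The operator $Ax_0=P_1\frac{\partial}{\partial\xi}(\mathcal Hx_0)+P_0\mathcal Hx_0$ with domain $\{x_0\in X:\mathcal Hx_0\in H^1([a,b],\mathbb K^n),\ \widetilde W_B\begin{bmatrix}(\mathcal Hx_0)(b)\\(\mathcal Hx_0)(a)\end{bmatrix}=0\}$ generates a $C_0$-semigroup on $X=L^2([a,b],\mathbb K^n)$ with inner product $\langle f,g\rangle_X=\frac12\int_a^bg^*\mathcal Hf\,d\xi$. $\rho(A)$ denotes the resolvent set of $A$ (if $\mathbb K=\mathbb R$, of its complexification). **Transfer function.** For $s\in\rho(A)$, $\mathbf G(s)$ is the unique $n\times n$ matrix such that for every $u_0$ the (unique) $x_0$ with $\mathcal Hx_0\in H^1$ satisfying $$sx_0(\xi)=P_1\tfrac{d}{d\xi}(\mathcal H(\xi)x_0(\xi))+P_0(\xi)\mathcal H(\xi)x_0(\xi),\qquad u_0=\widetilde W_B\begin{bmatrix}(\mathcal Hx_0)(b)\\(\mathcal Hx_0)(a)\end{bmatrix}$$ satisfies $\mathbf G(s)u_0=\widetilde W_C\begin{bmatrix}(\mathcal Hx_0)(b)\\(\mathcal Hx_0)(a)\end{bmatrix}$.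 **Fundamental solution.** For $s\in\mathbb C$, $\zeta\mapsto\Psi_\zeta^s$ is the continuous $n\times n$-matrix-valued fundamental solution on $[a,b]$ of $v'(\zeta)=-P_1^{-1}\left(P_0(\zeta)-s\mathcal H^{-1}(\zeta)\right)v(\zeta)$ with $\Psi_a^s=\mathbb 1_n$. *)

theory Defs
  imports "HOL-Analysis.Analysis"
begin

text \<open>
  The scalar field is a set \<open>K\<close> of complex numbers, either \<open>\<real>\<close> or \<open>UNIV\<close>; vectors and matrices
  over \<open>K\<close> are complex ones with all entries in \<open>K\<close>. The index type \<open>'n + 'n\<close> has \<open>2n\<close>
  elements; \<open>Inl\<close> indexes the upper block and \<open>Inr\<close> the lower block.
\<close>

definition vec_over :: "complex set \<Rightarrow> (complex ^ 'n) set" where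
  "vec_over K = {v. \<forall>i. v $ i \<in> K}"

definition mat_over :: "complex set \<Rightarrow> (complex ^ 'm ^ 'n) set" where
  "mat_over K = {M. \<forall>i j. M $ i $ j \<in> K}"

text \<open>Since a matrix is a vector of rows, \<open>stack\<close> serves for vectors and for block matrices.\<close>

definition stack :: "'a ^ 'm \<Rightarrow> 'a ^ 'k \<Rightarrow> 'a ^ ('m + 'k)" where
  "stack u v = (\<chi> i. case i of Inl j \<Rightarrow> u $ j | Inr j \<Rightarrow> v $ j)"

definition self_adjoint :: "complex ^ 'n ^ 'n \<Rightarrow> bool" where
  "self_adjoint M \<longleftrightarrow> (\<chi> i j. cnj (M $ j $ i)) = M"

text \<open>\<open>cdot v w\<close> is \<open>v\<^sup>* w\<close>.\<close>

definition cdot :: "complex ^ 'n \<Rightarrow> complex ^ 'n \<Rightarrow> complex" where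
  "cdot v w = (\<Sum>i\<in>UNIV. cnj (v $ i) * w $ i)"

definition loewner_le :: "complex set \<Rightarrow> complex ^ 'n ^ 'n \<Rightarrow> complex ^ 'n ^ 'n \<Rightarrow> bool" where
  "loewner_le K M N \<longleftrightarrow> (\<forall>v\<in>vec_over K. 0 \<le> Re (cdot v ((N - M) *v v)))"

text \<open>
  Elements of Lebesgue spaces are represented by functions; two representatives denote the same
  element if they agree almost everywhere on \<open>[a,b]\<close>. Values outside \<open>[a,b]\<close> are irrelevant.
\<close>

definition Linf_mat :: "complex set \<Rightarrow> real \<Rightarrow> real \<Rightarrow> (real \<Rightarrow> complex ^ 'n ^ 'n) set" where
  "Linf_mat K a b = {F. F \<in> borel_measurable (lebesgue_on {a..b}) \<and>
     (AE \<xi> in lebesgue_on {a..b}. F \<xi> \<in> mat_over K) \<and>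
     (\<exists>C. AE \<xi> in lebesgue_on {a..b}. norm (F \<xi>) \<le> C)}"

definition L2 :: "complex set \<Rightarrow> real \<Rightarrow> real \<Rightarrow> (real \<Rightarrow> complex ^ 'n) set" where
  "L2 K a b = {f. f \<in> borel_measurable (lebesgue_on {a..b}) \<and>
     (AE \<xi> in lebesgue_on {a..b}. f \<xi> \<in> vec_over K) \<and>
     integrable (lebesgue_on {a..b}) (\<lambda>\<xi>. (norm (f \<xi>))\<^sup>2)}"

text \<open>\<open>w\<close> is absolutely continuous on \<open>[a,b]\<close> with almost everywhere derivative \<open>g\<close>.\<close>

definition has_ac_deriv :: "real \<Rightarrow> real \<Rightarrow> (real \<Rightarrow> 'e::euclidean_space) \<Rightarrow> (real \<Rightarrow> 'e) \<Rightarrow> bool" where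
  "has_ac_deriv a b w g \<longleftrightarrow> g absolutely_integrable_on {a..b} \<and>
     (\<forall>\<xi>\<in>{a..b}. (g has_integral (w \<xi> - w a)) {a..\<xi>})"

text \<open>\<open>w\<close> is the continuous representative of an element of \<open>H\<^sup>1([a,b],K\<^sup>n)\<close> with derivative \<open>g\<close>.\<close>

definition has_H1_deriv ::
    "complex set \<Rightarrow> real \<Rightarrow> real \<Rightarrow> (real \<Rightarrow> complex ^ 'n) \<Rightarrow> (real \<Rightarrow> complex ^ 'n) \<Rightarrow> bool" where
  "has_H1_deriv K a b w g \<longleftrightarrow> w \<in> L2 K a b \<and> g \<in> L2 K a b \<and> has_ac_deriv a b w g"

definition inner_X :: "real \<Rightarrow> real \<Rightarrow> (real \<Rightarrow> complex ^ 'n ^ 'n) \<Rightarrow>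
    (real \<Rightarrow> complex ^ 'n) \<Rightarrow> (real \<Rightarrow> complex ^ 'n) \<Rightarrow> complex" where
  "inner_X a b H f g = 1 / 2 * (LINT \<xi>|lebesgue_on {a..b}. cdot (g \<xi>) (H \<xi> *v f \<xi>))"

definition norm_X ::
    "real \<Rightarrow> real \<Rightarrow> (real \<Rightarrow> complex ^ 'n ^ 'n) \<Rightarrow> (real \<Rightarrow> complex ^ 'n) \<Rightarrow> real" where
  "norm_X a b H f = sqrt (Re (inner_X a b H f f))"

text \<open>
  The operator theory below is for the normed \<open>K\<close>-space given by a set \<open>X\<close> of representatives and a
  seminorm \<open>N\<close>; representatives at distance zero are identified, so operators act on
  representatives and all identities between them hold up to \<open>N\<close>-distance zero. Unbounded operators
  are given by their graphs.
\<close>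

definition bounded_op :: "complex set \<Rightarrow> (real \<Rightarrow> complex ^ 'n) set \<Rightarrow> ((real \<Rightarrow> complex ^ 'n) \<Rightarrow> real) \<Rightarrow>
    ((real \<Rightarrow> complex ^ 'n) \<Rightarrow> (real \<Rightarrow> complex ^ 'n)) \<Rightarrow> bool" where
  "bounded_op K X N T \<longleftrightarrow>
     (\<forall>f\<in>X. T f \<in> X) \<and>
     (\<forall>f\<in>X. \<forall>g\<in>X. \<forall>c\<in>K. \<forall>d\<in>K.
        N (\<lambda>\<xi>. T (\<lambda>\<eta>. c *s f \<eta> + d *s g \<eta>) \<xi> - (c *s T f \<xi> + d *s T g \<xi>)) = 0) \<and>
     (\<exists>C. \<forall>f\<in>X. N (T f) \<le> C * N f)"

definition C0_semigroup :: "complex set \<Rightarrow> (real \<Rightarrow> complex ^ 'n) set \<Rightarrow> ((real \<Rightarrow> complex ^ 'n) \<Rightarrow> real) \<Rightarrow>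
    (real \<Rightarrow> (real \<Rightarrow> complex ^ 'n) \<Rightarrow> (real \<Rightarrow> complex ^ 'n)) \<Rightarrow> bool" where
  "C0_semigroup K X N T \<longleftrightarrow>
     (\<forall>t\<ge>0. bounded_op K X N (T t)) \<and>
     (\<forall>f\<in>X. N (\<lambda>\<xi>. T 0 f \<xi> - f \<xi>) = 0) \<and>
     (\<forall>r\<ge>0. \<forall>t\<ge>0. \<forall>f\<in>X. N (\<lambda>\<xi>. T (r + t) f \<xi> - T r (T t f) \<xi>) = 0) \<and>
     (\<forall>f\<in>X. ((\<lambda>t. N (\<lambda>\<xi>. T t f \<xi> - f \<xi>)) \<longlongrightarrow> 0) (at_right 0))"

definition generates_C0_semigroup ::
    "complex set \<Rightarrow> (real \<Rightarrow> complex ^ 'n) set \<Rightarrow> ((real \<Rightarrow> complex ^ 'n) \<Rightarrow> real) \<Rightarrow>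
     ((real \<Rightarrow> complex ^ 'n) \<times> (real \<Rightarrow> complex ^ 'n)) set \<Rightarrow> bool" where
  "generates_C0_semigroup K X N A \<longleftrightarrow> (\<exists>T. C0_semigroup K X N T \<and>
     A = {(f, g). f \<in> X \<and> g \<in> X \<and>
       ((\<lambda>t. N (\<lambda>\<xi>. (1 / t) *\<^sub>R (T t f \<xi> - f \<xi>) - g \<xi>)) \<longlongrightarrow> 0) (at_right 0)})"

definition resolvent_set :: "(real \<Rightarrow> complex ^ 'n) set \<Rightarrow> ((real \<Rightarrow> complex ^ 'n) \<Rightarrow> real) \<Rightarrow>
    ((real \<Rightarrow> complex ^ 'n) \<times> (real \<Rightarrow> complex ^ 'n)) set \<Rightarrow> complex set" where
  "resolvent_set X N A = {s. \<exists>R. bounded_op UNIV X N R \<and>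
     (\<forall>y\<in>X. \<exists>z. (R y, z) \<in> A \<and> N (\<lambda>\<xi>. (s *s R y \<xi> - z \<xi>) - y \<xi>) = 0) \<and>
     (\<forall>(x, z)\<in>A. N (\<lambda>\<xi>. R (\<lambda>\<eta>. s *s x \<eta> - z \<eta>) \<xi> - x \<xi>) = 0)}"

definition complexification :: "((real \<Rightarrow> complex ^ 'n) \<times> (real \<Rightarrow> complex ^ 'n)) set \<Rightarrow>
    ((real \<Rightarrow> complex ^ 'n) \<times> (real \<Rightarrow> complex ^ 'n)) set" where
  "complexification A = {(\<lambda>\<xi>. x \<xi> + \<i> *s y \<xi>, \<lambda>\<xi>. u \<xi> + \<i> *s v \<xi>) | x u y v. (x, u) \<in> A \<and> (y, v) \<in> A}"

text \<open>
  \<open>z = P\<^sub>1 (H x)' + P\<^sub>0 H x\<close> in \<open>L\<^sup>2\<close>, where \<open>H x\<close> belongs to \<open>H\<^sup>1\<close> and has continuous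
  representative \<open>w\<close>; the boundary values \<open>(H x)(a)\<close> and \<open>(H x)(b)\<close> are \<open>w a\<close> and \<open>w b\<close>.
\<close>

definition hbcs_rel :: "complex set \<Rightarrow> real \<Rightarrow> real \<Rightarrow> complex ^ 'n ^ 'n \<Rightarrow> (real \<Rightarrow> complex ^ 'n ^ 'n) \<Rightarrow>
    (real \<Rightarrow> complex ^ 'n ^ 'n) \<Rightarrow> (real \<Rightarrow> complex ^ 'n) \<Rightarrow> (real \<Rightarrow> complex ^ 'n) \<Rightarrow> (real \<Rightarrow> complex ^ 'n) \<Rightarrow> bool" where
  "hbcs_rel K a b P1 P0 H x w z \<longleftrightarrow> x \<in> L2 K a b \<and> z \<in> L2 K a b \<and>
     (\<exists>g. has_H1_deriv K a b w g \<and>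
       (AE \<xi> in lebesgue_on {a..b}. w \<xi> = H \<xi> *v x \<xi>) \<and>
       (AE \<xi> in lebesgue_on {a..b}. z \<xi> = P1 *v g \<xi> + P0 \<xi> *v (H \<xi> *v x \<xi>)))"

definition hbcs_operator :: "complex set \<Rightarrow> real \<Rightarrow> real \<Rightarrow> complex ^ 'n ^ 'n \<Rightarrow> (real \<Rightarrow> complex ^ 'n ^ 'n) \<Rightarrow>
    (real \<Rightarrow> complex ^ 'n ^ 'n) \<Rightarrow> complex ^ ('n + 'n) ^ 'n \<Rightarrow>
    ((real \<Rightarrow> complex ^ 'n) \<times> (real \<Rightarrow> complex ^ 'n)) set" where
  "hbcs_operator K a b P1 P0 H WB =
     {(x, z). \<exists>w. hbcs_rel K a b P1 P0 H x w z \<and> WB *v stack (w b) (w a) = 0}"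

definition hbcs_resolvent_set :: "complex set \<Rightarrow> real \<Rightarrow> real \<Rightarrow> complex ^ 'n ^ 'n \<Rightarrow>
    (real \<Rightarrow> complex ^ 'n ^ 'n) \<Rightarrow> (real \<Rightarrow> complex ^ 'n ^ 'n) \<Rightarrow> complex ^ ('n + 'n) ^ 'n \<Rightarrow> complex set" where
  "hbcs_resolvent_set K a b P1 P0 H WB = resolvent_set (L2 UNIV a b) (norm_X a b H)
     (if K = \<real> then complexification (hbcs_operator K a b P1 P0 H WB)
      else hbcs_operator K a b P1 P0 H WB)"

definition hbcs :: "complex set \<Rightarrow> real \<Rightarrow> real \<Rightarrow> complex ^ 'n ^ 'n \<Rightarrow> (real \<Rightarrow> complex ^ 'n ^ 'n) \<Rightarrow>
    (real \<Rightarrow> complex ^ 'n ^ 'n) \<Rightarrow> complex ^ ('n + 'n) ^ 'n \<Rightarrow> complex ^ ('n + 'n) ^ 'n \<Rightarrow> bool" where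
  "hbcs K a b P1 P0 H WB WC \<longleftrightarrow>
     K \<in> {\<real>, UNIV} \<and> a < b \<and>
     P1 \<in> mat_over K \<and> invertible P1 \<and> self_adjoint P1 \<and>
     P0 \<in> Linf_mat K a b \<and>
     H \<in> Linf_mat K a b \<and>
     (\<exists>m0>0. \<exists>M0>0. AE \<xi> in lebesgue_on {a..b}. self_adjoint (H \<xi>) \<and>
        loewner_le K (mat (complex_of_real m0)) (H \<xi>) \<and>
        loewner_le K (H \<xi>) (mat (complex_of_real M0))) \<and>
     WB \<in> mat_over K \<and> WC \<in> mat_over K \<and>
     rank WB = CARD('n) \<and> rank (stack WB WC) = 2 * CARD('n) \<and>
     generates_C0_semigroup K (L2 K a b) (norm_X a b H) (hbcs_operator K a b P1 P0 H WB)"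

definition hbcs_stationary :: "real \<Rightarrow> real \<Rightarrow> complex ^ 'n ^ 'n \<Rightarrow> (real \<Rightarrow> complex ^ 'n ^ 'n) \<Rightarrow>
    (real \<Rightarrow> complex ^ 'n ^ 'n) \<Rightarrow> complex ^ ('n + 'n) ^ 'n \<Rightarrow> complex \<Rightarrow> complex ^ 'n \<Rightarrow>
    (real \<Rightarrow> complex ^ 'n) \<Rightarrow> (real \<Rightarrow> complex ^ 'n) \<Rightarrow> bool" where
  "hbcs_stationary a b P1 P0 H WB s u x w \<longleftrightarrow>
     hbcs_rel UNIV a b P1 P0 H x w (\<lambda>\<xi>. s *s x \<xi>) \<and> u = WB *v stack (w b) (w a)"

definition is_transfer_matrix :: "real \<Rightarrow> real \<Rightarrow> complex ^ 'n ^ 'n \<Rightarrow> (real \<Rightarrow> complex ^ 'n ^ 'n) \<Rightarrow>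
    (real \<Rightarrow> complex ^ 'n ^ 'n) \<Rightarrow> complex ^ ('n + 'n) ^ 'n \<Rightarrow> complex ^ ('n + 'n) ^ 'n \<Rightarrow> complex \<Rightarrow>
    complex ^ 'n ^ 'n \<Rightarrow> bool" where
  "is_transfer_matrix a b P1 P0 H WB WC s G \<longleftrightarrow>
     (\<forall>u. \<exists>x w. hbcs_stationary a b P1 P0 H WB s u x w \<and>
        (\<forall>x' w'. hbcs_stationary a b P1 P0 H WB s u x' w' \<longrightarrow>
           (AE \<xi> in lebesgue_on {a..b}. x' \<xi> = x \<xi>)) \<and>
        G *v u = WC *v stack (w b) (w a))"

definition transfer_function :: "real \<Rightarrow> real \<Rightarrow> complex ^ 'n ^ 'n \<Rightarrow> (real \<Rightarrow> complex ^ 'n ^ 'n) \<Rightarrow>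
    (real \<Rightarrow> complex ^ 'n ^ 'n) \<Rightarrow> complex ^ ('n + 'n) ^ 'n \<Rightarrow> complex ^ ('n + 'n) ^ 'n \<Rightarrow> complex \<Rightarrow>
    complex ^ 'n ^ 'n" where
  "transfer_function a b P1 P0 H WB WC s = (THE G. is_transfer_matrix a b P1 P0 H WB WC s G)"

text \<open>
  The coefficients are only bounded and measurable, so the differential equation holds almost
  everywhere for an absolutely continuous \<open>\<Psi>\<close>.
\<close>

definition fundamental_solution :: "real \<Rightarrow> real \<Rightarrow> complex ^ 'n ^ 'n \<Rightarrow> (real \<Rightarrow> complex ^ 'n ^ 'n) \<Rightarrow>
    (real \<Rightarrow> complex ^ 'n ^ 'n) \<Rightarrow> complex \<Rightarrow> (real \<Rightarrow> complex ^ 'n ^ 'n) \<Rightarrow> bool" where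
  "fundamental_solution a b P1 P0 H s \<Psi> \<longleftrightarrow>
     continuous_on {a..b} \<Psi> \<and> \<Psi> a = mat 1 \<and>
     (\<exists>D. has_ac_deriv a b \<Psi> D \<and>
       (AE \<zeta> in lebesgue_on {a..b}.
          D \<zeta> = - (matrix_inv P1 ** (P0 \<zeta> - mat s ** matrix_inv (H \<zeta>))) ** \<Psi> \<zeta>))"

end

theory Submission
  imports Defs
begin

text \<open>
  Since \<open>H\<close> is uniformly positive definite, also on complex vectors, its inverse is bounded and
  measurable, and \<open>w = H x\<close> turns the stationary equation into the linear differential equation
  defining \<open>\<Psi>\<close>. By Gronwall's lemma its solutions are exactly \<open>w = \<Psi> v\<close> with \<open>v = w a\<close>, and their
  boundary values are \<open>stack (\<Psi> b) (mat 1) *v v\<close>. If \<open>WB ** stack (\<Psi> b) (mat 1)\<close> annihilates \<open>v\<close>, then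
  \<open>x = H\<^sup>-\<^sup>1 \<Psi> v\<close> satisfies \<open>A x = s x\<close>, so \<open>x = 0\<close> because \<open>s\<close> is in the resolvent set, and hence
  \<open>v = 0\<close>. So the input \<open>u\<close> determines \<open>v\<close> and thereby the output.
\<close>

section \<open>Matrices over the complex numbers\<close>

lemma bounded_bilinear_matrix_vector_mult:
  "bounded_bilinear ((*v) :: complex ^ 'm ^ 'n \<Rightarrow> complex ^ 'm \<Rightarrow> complex ^ 'n)"
proof -
  have "bilinear ((*v) :: complex ^ 'm ^ 'n \<Rightarrow> complex ^ 'm \<Rightarrow> complex ^ 'n)"
    unfolding bilinear_def
    by (auto intro!: linearI simp: matrix_vector_mult_def vec_eq_iff algebra_simps
        sum.distrib scaleR_right.sum)
  then show ?thesis
    by (simp add: bilinear_conv_bounded_bilinear)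
qed

lemma borel_measurable_matrix_vector_mult:
  fixes A :: "'a \<Rightarrow> complex ^ 'm ^ 'n"
  assumes "A \<in> borel_measurable M" "x \<in> borel_measurable M"
  shows "(\<lambda>\<xi>. A \<xi> *v x \<xi>) \<in> borel_measurable M"
  using assms
  by (rule borel_measurable_continuous_Pair)
    (intro bounded_bilinear.continuous_on[OF bounded_bilinear_matrix_vector_mult]
      continuous_intros)

lemma borel_measurable_vec_iff:
  fixes f :: "'a \<Rightarrow> 'b::euclidean_space ^ 'n"
  shows "f \<in> borel_measurable M \<longleftrightarrow> (\<forall>i. (\<lambda>x. f x $ i) \<in> borel_measurable M)"
  by (subst borel_measurable_euclidean_space, subst borel_measurable_euclidean_space)
    (auto simp: Basis_vec_def inner_axis)

lemma borel_measurable_det: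
  fixes A :: "'a \<Rightarrow> complex ^ 'n ^ 'n"
  assumes "A \<in> borel_measurable M"
  shows "(\<lambda>\<xi>. det (A \<xi>)) \<in> borel_measurable M"
proof -
  have "(\<lambda>\<xi>. A \<xi> $ i $ j) \<in> borel_measurable M" for i j
    using assms by (simp add: borel_measurable_vec_iff)
  then show ?thesis
    unfolding det_def by (intro borel_measurable_sum borel_measurable_times borel_measurable_prod) auto
qed

text \<open>Turns complex scaling into a matrix action, so that boundedness and measurability of
  matrix products also cover \<open>c *s v\<close>.\<close>

lemma mat_scalar_vector_mult: "mat c *v v = c *s (v :: complex ^ 'n)"
  by (simp add: mat_def matrix_vector_mult_def vec_eq_iff if_distrib if_distribR cong: if_cong)

lemma matrix_inv_mult:
  fixes A :: "complex ^ 'n ^ 'n"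
  assumes "invertible A"
  shows "A ** matrix_inv A = mat 1" "matrix_inv A ** A = mat 1"
  using someI_ex[OF assms[unfolded invertible_def]] unfolding matrix_inv_def by auto

lemma matrix_inv_vector_mult:
  fixes A :: "complex ^ 'n ^ 'n"
  assumes "invertible A"
  shows "A *v (matrix_inv A *v v) = v" "matrix_inv A *v (A *v v) = v"
  by (simp_all add: matrix_vector_mul_assoc matrix_inv_mult[OF assms])

text \<open>Cramer's rule for \<open>A *v y = axis l 1\<close>, whose solution \<open>y\<close> is
  column \<open>l\<close> of the inverse. Entries become quotients of determinants, which makes
  their measurability in \<open>A\<close> accessible.\<close>

lemma matrix_inv_eq_det:
  fixes A :: "complex ^ 'n ^ 'n"
  assumes "det A \<noteq> 0"
  shows "matrix_inv A $ k $ l =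
    det (\<chi> i j. if j = k then axis l 1 $ i else A $ i $ j) / det A"
proof -
  have "invertible A"
    using assms by (simp add: invertible_det_nz)
  then have "A *v (matrix_inv A *v axis l 1) = axis l 1"
    by (rule matrix_inv_vector_mult)
  then have "(matrix_inv A *v axis l 1) $ k =
      det (\<chi> i j. if j = k then axis l 1 $ i else A $ i $ j) / det A"
    unfolding cramer[OF assms] by (simp add: vec_eq_iff)
  moreover have "(matrix_inv A *v axis l 1) $ k = matrix_inv A $ k $ l"
    by (simp add: matrix_vector_mult_def axis_def if_distrib cong: if_cong)
  ultimately show ?thesis
    by simp
qed

text \<open>No invertibility is assumed: \<open>matrix_inv\<close> takes the same junk value on all singular matrices.\<close>

lemma borel_measurable_matrix_inv:
  fixes A :: "'a \<Rightarrow> complex ^ 'n ^ 'n"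
  assumes A: "A \<in> borel_measurable M"
  shows "(\<lambda>\<xi>. matrix_inv (A \<xi>)) \<in> borel_measurable M"
proof -
  define c :: "complex ^ 'n ^ 'n" where "c = (SOME B. False)"
  have c: "matrix_inv B = c" if "det B = 0" for B :: "complex ^ 'n ^ 'n"
  proof -
    have "\<not> invertible B"
      using that by (simp add: invertible_det_nz)
    then have "(\<lambda>B'. B ** B' = mat 1 \<and> B' ** B = mat 1) = (\<lambda>B'. False)"
      unfolding invertible_def by blast
    then show ?thesis
      unfolding matrix_inv_def c_def by (rule arg_cong)
  qed
  have entry: "(\<lambda>\<xi>. A \<xi> $ i $ j) \<in> borel_measurable M" for i j
    using A by (simp add: borel_measurable_vec_iff)
  have "(\<lambda>\<xi>. matrix_inv (A \<xi>) $ k $ l) \<in> borel_measurable M" for k l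
  proof -
    have "(\<lambda>\<xi>. matrix_inv (A \<xi>) $ k $ l) = (\<lambda>\<xi>. if det (A \<xi>) = 0 then c $ k $ l
        else det (\<chi> i j. if j = k then axis l 1 $ i else A \<xi> $ i $ j) / det (A \<xi>))"
      by (auto simp: c matrix_inv_eq_det)
    moreover have "(\<lambda>\<xi>. det (\<chi> i j. if j = k then axis l 1 $ i else A \<xi> $ i $ j))
        \<in> borel_measurable M"
    proof (intro borel_measurable_det)
      have "(\<lambda>\<xi>. if j = k then axis l 1 $ i else A \<xi> $ i $ j) \<in> borel_measurable M" for i j
        using entry by (cases "j = k") auto
      then show "(\<lambda>\<xi>. \<chi> i j. if j = k then axis l 1 $ i else A \<xi> $ i $ j) \<in> borel_measurable M"
        by (simp add: borel_measurable_vec_iff)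
    qed
    moreover note borel_measurable_det[OF A]
    ultimately show ?thesis
      by simp
  qed
  then show ?thesis
    by (simp add: borel_measurable_vec_iff)
qed

text \<open>Lets Loewner bounds and the norm of the state space be read in the real inner product of
  the Euclidean space \<open>complex ^ 'n\<close>.\<close>

lemma Re_cdot: "Re (cdot v w) = v \<bullet> w"
  by (simp add: cdot_def inner_vec_def inner_complex_def)

text \<open>Cauchy-Schwarz turns coercivity into \<open>m * norm v \<le> norm (A *v v)\<close>. So
  \<open>A\<close> is injective, hence invertible as a square matrix, and the same bound at
  \<open>matrix_inv A *v v\<close> estimates the inverse.\<close>

lemma coercive_matrix_invertible:
  fixes A :: "complex ^ 'n ^ 'n"
  assumes "m > 0" and coercive: "\<And>v. m * (norm v)\<^sup>2 \<le> v \<bullet> (A *v v)"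
  shows "invertible A" and "norm (matrix_inv A *v v) \<le> norm v / m"
proof -
  have bound: "m * norm v \<le> norm (A *v v)" for v
  proof (cases "v = 0")
    case False
    have "m * (norm v)\<^sup>2 \<le> norm v * norm (A *v v)"
      using coercive[of v] norm_cauchy_schwarz[of v "A *v v"] by linarith
    then show ?thesis
      using False by (simp add: power2_eq_square)
  qed simp
  have "v = 0" if "A *v v = 0" for v
    using bound[of v] that \<open>m > 0\<close> by (simp add: mult_le_0_iff)
  then show inv: "invertible A"
    by (simp add: invertible_left_inverse matrix_left_invertible_ker)
  show "norm (matrix_inv A *v v) \<le> norm v / m"
    using bound[of "matrix_inv A *v v"] \<open>m > 0\<close>
    by (simp add: matrix_inv_vector_mult[OF inv] field_simps)
qed

lemma stack_vector_mult: "stack A B *v v = stack (A *v v) (B *v (v :: complex ^ 'n))"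
  by (auto simp: stack_def matrix_vector_mult_def vec_eq_iff split: sum.split)

section \<open>Real and imaginary parts\<close>

text \<open>Both parts remain complex vectors, with real entries, because this is how vectors over
  \<open>\<real>\<close> are encoded.\<close>

definition real_part :: "complex ^ 'n \<Rightarrow> complex ^ 'n" where
  "real_part v = (\<chi> i. of_real (Re (v $ i)))"

definition imag_part :: "complex ^ 'n \<Rightarrow> complex ^ 'n" where
  "imag_part v = (\<chi> i. of_real (Im (v $ i)))"

lemma real_imag_decomposition: "v = real_part v + \<i> *s imag_part v"
  by (simp add: vec_eq_iff real_part_def imag_part_def complex_eq)

text \<open>Here and below \<open>Q\<close> stands for either part, so that each fact is proved once
  for both.\<close>

lemma part_in_vec_over:
  assumes "Q \<in> {real_part, imag_part}"
  shows "Q v \<in> vec_over \<real>"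
  using assms by (auto simp: vec_over_def real_part_def imag_part_def)

lemma norm_part_le:
  assumes "Q \<in> {real_part, imag_part}"
  shows "norm (Q v) \<le> norm v"
  using assms
  by (auto simp: real_part_def imag_part_def norm_vec_def abs_Re_le_cmod abs_Im_le_cmod
      intro!: L2_set_mono)

lemma bounded_linear_part:
  assumes "Q \<in> {real_part, imag_part}"
  shows "bounded_linear Q"
proof -
  have "linear Q"
    using assms by (auto intro!: linearI simp: real_part_def imag_part_def vec_eq_iff complex_eq_iff)
  then show ?thesis
    by (simp add: linear_conv_bounded_linear)
qed

lemma
  assumes "M \<in> mat_over \<real>"
  shows real_part_matrix_vector_mult: "real_part (M *v v) = M *v real_part v"
    and imag_part_matrix_vector_mult: "imag_part (M *v v) = M *v imag_part v"
proof -
  have "Im (M $ i $ j) = 0" for i j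
    using assms by (auto simp: mat_over_def complex_is_Real_iff)
  then show "real_part (M *v v) = M *v real_part v" "imag_part (M *v v) = M *v imag_part v"
    by (auto simp: real_part_def imag_part_def matrix_vector_mult_def vec_eq_iff complex_eq_iff)
qed

text \<open>Taking parts commutes with stacking and with real matrices, so both parts of a function
  inherit its homogeneous boundary condition.\<close>

lemma part_boundary_kernel:
  assumes Q: "Q \<in> {real_part, imag_part}" and M: "M \<in> mat_over \<real>"
    and 0: "M *v stack v w = 0"
  shows "M *v stack (Q v) (Q w) = 0"
proof -
  have "stack (real_part v) (real_part w) = real_part (stack v w)"
    "stack (imag_part v) (imag_part w) = imag_part (stack v w)"
    by (auto simp: real_part_def imag_part_def stack_def vec_eq_iff split: sum.split)
  moreover have "M *v real_part (stack v w) = 0" "M *v imag_part (stack v w) = 0"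
    using 0 real_part_matrix_vector_mult[OF M, of "stack v w"]
      imag_part_matrix_vector_mult[OF M, of "stack v w"]
    by (simp_all add: real_part_def imag_part_def vec_eq_iff)
  ultimately show ?thesis
    using Q by auto
qed

text \<open>For real \<open>M\<close> the two cross terms between real and imaginary part are purely
  imaginary and vanish in the real inner product.\<close>

lemma inner_real_imag:
  assumes "M \<in> mat_over \<real>"
  shows "v \<bullet> (M *v v) = real_part v \<bullet> (M *v real_part v) + imag_part v \<bullet> (M *v imag_part v)"
proof -
  have "Im (M $ i $ j) = 0" for i j
    using assms by (auto simp: mat_over_def complex_is_Real_iff)
  then show ?thesis
    by (simp add: inner_vec_def matrix_vector_mult_def real_part_def imag_part_def
        inner_complex_def sum.distrib)
qed

lemma norm_real_imag: "(norm v)\<^sup>2 = (norm (real_part v))\<^sup>2 + (norm (imag_part v))\<^sup>2"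
  by (simp add: power2_norm_eq_inner inner_vec_def real_part_def imag_part_def
        inner_complex_def sum.distrib)

section \<open>Absolutely continuous functions and square integrable functions\<close>

text \<open>Translates from the measure-theoretic language to the negligible sets of the gauge
  integral, where \<open>has_integral_spike\<close> applies.\<close>

lemma AE_lebesgue_on_negligible:
  assumes "AE \<xi> in lebesgue_on {a..b::real}. P \<xi>"
  obtains N where "negligible N" "\<And>\<xi>. \<xi> \<in> {a..b} \<Longrightarrow> \<xi> \<notin> N \<Longrightarrow> P \<xi>"
proof -
  have "AE \<xi> in lebesgue. \<xi> \<in> {a..b} \<longrightarrow> P \<xi>"
    using assms by (simp add: AE_restrict_space_iff)
  then show ?thesis
    using that unfolding eventually_ae_filter_negligible by blast
qed

lemma has_ac_deriv_continuous_on: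
  assumes "has_ac_deriv a b w g"
  shows "continuous_on {a..b} w"
proof -
  have "g integrable_on {a..b}"
    using assms by (simp add: has_ac_deriv_def set_lebesgue_integral_eq_integral(1))
  then have "continuous_on {a..b} (\<lambda>\<xi>. w a + integral {a..\<xi>} g)"
    by (intro continuous_intros indefinite_integral_continuous_1)
  moreover have "w a + integral {a..\<xi>} g = w \<xi>" if "\<xi> \<in> {a..b}" for \<xi>
  proof -
    have "(g has_integral (w \<xi> - w a)) {a..\<xi>}"
      using assms that by (auto simp: has_ac_deriv_def)
    then show ?thesis
      by (simp add: integral_unique)
  qed
  ultimately show ?thesis
    by (rule continuous_on_eq)
qed

lemma has_ac_deriv_linear:
  assumes "has_ac_deriv a b w g" and T: "bounded_linear T"
  shows "has_ac_deriv a b (\<lambda>\<xi>. T (w \<xi>)) (\<lambda>\<xi>. T (g \<xi>))"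
  unfolding has_ac_deriv_def
proof (intro conjI ballI)
  show "(\<lambda>\<xi>. T (g \<xi>)) absolutely_integrable_on {a..b}"
    using absolutely_integrable_linear[of "{a..b}" g, OF _ T] assms(1)
    by (simp add: has_ac_deriv_def o_def)
  fix \<xi> assume "\<xi> \<in> {a..b}"
  then have "(g has_integral (w \<xi> - w a)) {a..\<xi>}"
    using assms(1) by (simp add: has_ac_deriv_def)
  from has_integral_linear[OF this T]
  show "((\<lambda>\<xi>. T (g \<xi>)) has_integral T (w \<xi>) - T (w a)) {a..\<xi>}"
    by (simp add: o_def linear_diff[OF bounded_linear.linear[OF T]])
qed

lemma has_ac_deriv_diff:
  assumes "has_ac_deriv a b w g" "has_ac_deriv a b w' g'"
  shows "has_ac_deriv a b (\<lambda>\<xi>. w \<xi> - w' \<xi>) (\<lambda>\<xi>. g \<xi> - g' \<xi>)"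
  unfolding has_ac_deriv_def
proof (intro conjI ballI)
  show "(\<lambda>\<xi>. g \<xi> - g' \<xi>) absolutely_integrable_on {a..b}"
    using assms by (intro set_integral_diff) (auto simp: has_ac_deriv_def)
  fix \<xi> assume "\<xi> \<in> {a..b}"
  then have "((\<lambda>\<xi>. g \<xi> - g' \<xi>) has_integral (w \<xi> - w a) - (w' \<xi> - w' a)) {a..\<xi>}"
    using assms by (intro has_integral_diff) (auto simp: has_ac_deriv_def)
  then show "((\<lambda>\<xi>. g \<xi> - g' \<xi>) has_integral w \<xi> - w' \<xi> - (w a - w' a)) {a..\<xi>}"
    by (simp add: algebra_simps)
qed

text \<open>
  Gronwall's lemma: the maximum \<open>M\<close> of \<open>norm (w \<xi>) exp (- 2 L (\<xi> - a))\<close> satisfies \<open>M \<le> M / 2\<close>.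
\<close>

lemma has_ac_deriv_eq_0:
  assumes ac: "has_ac_deriv a b w g" and "w a = 0" and "L > 0"
    and bound: "AE \<xi> in lebesgue_on {a..b}. norm (g \<xi>) \<le> L * norm (w \<xi>)"
    and \<xi>: "\<xi> \<in> {a..b}"
  shows "w \<xi> = 0"
proof -
  \<comment> \<open>The exponent \<open>2 * L\<close> is chosen so that integrating
    \<open>L * exp (2 * L * (\<eta> - a))\<close> leaves the factor 1/2.\<close>
  define \<phi> where "\<phi> \<eta> = norm (w \<eta>) * exp (- (2 * L * (\<eta> - a)))" for \<eta>
  obtain N where N: "negligible N"
    "\<And>\<eta>. \<eta> \<in> {a..b} \<Longrightarrow> \<eta> \<notin> N \<Longrightarrow> norm (g \<eta>) \<le> L * norm (w \<eta>)"
    using AE_lebesgue_on_negligible[OF bound] by blast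
  have "continuous_on {a..b} \<phi>"
    unfolding \<phi>_def by (intro continuous_intros has_ac_deriv_continuous_on[OF ac])
  then obtain t where t: "t \<in> {a..b}" "\<And>\<eta>. \<eta> \<in> {a..b} \<Longrightarrow> \<phi> \<eta> \<le> \<phi> t"
    using continuous_attains_sup[of "{a..b}" \<phi>] \<xi> by auto
  define M where "M = \<phi> t"
  have "M \<ge> 0"
    by (simp add: M_def \<phi>_def)
  have w_le: "norm (w \<eta>) \<le> M * exp (2 * L * (\<eta> - a))" if "\<eta> \<in> {a..b}" for \<eta>
    using t(2)[OF that] unfolding M_def[symmetric]
    by (simp add: \<phi>_def exp_minus pos_divide_le_eq flip: divide_inverse)
  \<comment> \<open>The comparison of integrals below asks for a bound at every point, so
    \<open>g\<close> is reset to 0 on the exceptional null set.\<close>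
  define h where "h \<eta> = (if \<eta> \<in> N then 0 else g \<eta>)" for \<eta>
  have "(g has_integral w t) {a..t}"
    using ac t(1) \<open>w a = 0\<close> by (auto simp: has_ac_deriv_def)
  then have h: "(h has_integral w t) {a..t}"
    by (rule has_integral_spike[OF N(1), rotated]) (auto simp: h_def)
  have "((\<lambda>\<eta>. L * M * exp (2 * L * (\<eta> - a))) has_integral
      M / 2 * exp (2 * L * (t - a)) - M / 2 * exp (2 * L * (a - a))) {a..t}"
    using t(1) \<open>L > 0\<close>
    by (intro fundamental_theorem_of_calculus)
      (auto intro!: derivative_eq_intros simp flip: has_real_derivative_iff_has_vector_derivative)
  then have e: "((\<lambda>\<eta>. L * M * exp (2 * L * (\<eta> - a))) has_integral
      M / 2 * exp (2 * L * (t - a)) - M / 2) {a..t}"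
    by simp
  have "norm (integral {a..t} h) \<le> integral {a..t} (\<lambda>\<eta>. L * M * exp (2 * L * (\<eta> - a)))"
  proof (rule integral_norm_bound_integral)
    show "norm (h \<eta>) \<le> L * M * exp (2 * L * (\<eta> - a))" if "\<eta> \<in> {a..t}" for \<eta>
    proof -
      have "\<eta> \<in> {a..b}"
        using that t(1) by auto
      then have "norm (h \<eta>) \<le> L * norm (w \<eta>)"
        using N(2) \<open>L > 0\<close> by (auto simp: h_def)
      also have "\<dots> \<le> L * (M * exp (2 * L * (\<eta> - a)))"
        using w_le[OF \<open>\<eta> \<in> {a..b}\<close>] \<open>L > 0\<close> by simp
      finally show ?thesis
        by (simp add: mult.assoc)
    qed
  qed (use h e in blast)+
  then have "norm (w t) \<le> M / 2 * exp (2 * L * (t - a)) - M / 2"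
    unfolding integral_unique[OF h] integral_unique[OF e] .
  moreover have "norm (w t) = M * exp (2 * L * (t - a))"
    by (simp add: M_def \<phi>_def exp_minus)
  \<comment> \<open>With \<open>E = exp (2 * L * (t - a))\<close>, the two facts give
    \<open>M * E \<le> M / 2 * E - M / 2\<close>, that is, \<open>M * E \<le> - M\<close>.\<close>
  ultimately have "M * exp (2 * L * (t - a)) \<le> 0"
    using \<open>M \<ge> 0\<close> by (simp add: field_simps)
  then have "M = 0"
    using \<open>M \<ge> 0\<close> by (simp add: mult_le_0_iff)
  then show ?thesis
    using w_le[OF \<xi>] by simp
qed

text \<open>If \<open>w a\<close> were nonzero, \<open>w\<close> would be nonzero on a nondegenerate
  interval starting at \<open>a\<close>, and that interval would be contained in a null set.\<close>

lemma continuous_on_AE_0_left_endpoint: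
  fixes w :: "real \<Rightarrow> 'b::real_normed_vector"
  assumes "a < b" "continuous_on {a..b} w" "AE \<xi> in lebesgue_on {a..b}. w \<xi> = 0"
  shows "w a = 0"
proof (rule ccontr)
  assume "w a \<noteq> 0"
  obtain N where N: "negligible N" "\<And>\<xi>. \<xi> \<in> {a..b} \<Longrightarrow> \<xi> \<notin> N \<Longrightarrow> w \<xi> = 0"
    using AE_lebesgue_on_negligible[OF assms(3)] by blast
  obtain d where d: "d > 0" "\<And>\<xi>. \<xi> \<in> {a..b} \<Longrightarrow> dist \<xi> a < d \<Longrightarrow> dist (w \<xi>) (w a) < norm (w a)"
    using assms(1,2) \<open>w a \<noteq> 0\<close> unfolding continuous_on_iff
    by (metis atLeastAtMost_iff less_eq_real_def order_refl zero_less_norm_iff)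
  \<comment> \<open>Halving \<open>d\<close> keeps the closed interval strictly within distance
    \<open>d\<close> of \<open>a\<close>; the minimum keeps it inside \<open>{a..b}\<close>.\<close>
  define c where "c = min b (a + d / 2)"
  have "{a..c} \<subseteq> N"
  proof
    fix \<xi> assume "\<xi> \<in> {a..c}"
    then have "\<xi> \<in> {a..b}" "dist \<xi> a < d"
      using d(1) by (auto simp: c_def dist_real_def)
    then show "\<xi> \<in> N"
      using N(2)[of \<xi>] d(2)[of \<xi>] by fastforce
  qed
  then have "negligible {a..c}"
    using N(1) negligible_subset by blast
  moreover have "a < c"
    using assms(1) d(1) by (simp add: c_def)
  ultimately show False
    using negligible_interval(1)[of a c] by (auto simp: box_eq_empty)
qed

section \<open>Square integrable functions\<close>

lemma bounded_measurable_in_L2: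
  assumes "f \<in> borel_measurable (lebesgue_on {a..b})"
    and bound: "AE \<xi> in lebesgue_on {a..b}. norm (f \<xi>) \<le> C"
  shows "f \<in> L2 UNIV a b"
proof -
  have "integrable (lebesgue_on {a..b}) (\<lambda>\<xi>. (norm (f \<xi>))\<^sup>2)"
  proof (rule Bochner_Integration.integrable_bound[of _ "\<lambda>_. C\<^sup>2"])
    show "AE \<xi> in lebesgue_on {a..b}. norm ((norm (f \<xi>))\<^sup>2) \<le> norm (C\<^sup>2)"
      using bound by eventually_elim (simp add: power_mono)
  qed (use assms(1) in auto)
  then show ?thesis
    using assms by (simp add: L2_def vec_over_def)
qed

lemma continuous_on_in_L2:
  assumes "continuous_on {a..b} f"
  shows "f \<in> L2 UNIV a b"
proof -
  have "bounded (f ` {a..b})"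
    using assms by (intro compact_imp_bounded compact_continuous_image) auto
  then obtain C where "\<And>\<xi>. \<xi> \<in> {a..b} \<Longrightarrow> norm (f \<xi>) \<le> C"
    by (force simp: bounded_iff)
  then have "AE \<xi> in lebesgue_on {a..b}. norm (f \<xi>) \<le> C"
    by (intro AE_I2) auto
  then show ?thesis
    using assms by (intro bounded_measurable_in_L2 continuous_imp_measurable_on_sets_lebesgue) auto
qed

lemma L2_diff:
  assumes "f \<in> L2 UNIV a b" "g \<in> L2 UNIV a b"
  shows "(\<lambda>\<xi>. f \<xi> - g \<xi>) \<in> L2 UNIV a b"
proof -
  have "integrable (lebesgue_on {a..b}) (\<lambda>\<xi>. 2 * (norm (f \<xi>))\<^sup>2 + 2 * (norm (g \<xi>))\<^sup>2)"
    using assms by (auto simp: L2_def)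
  then have "integrable (lebesgue_on {a..b}) (\<lambda>\<xi>. (norm (f \<xi> - g \<xi>))\<^sup>2)"
  proof (rule Bochner_Integration.integrable_bound)
    have "(norm (x - y))\<^sup>2 \<le> 2 * (norm x)\<^sup>2 + 2 * (norm y)\<^sup>2" for x y :: "complex ^ 'a"
    proof -
      \<comment> \<open>The parallelogram identity; dropping the square of the sum gives the
        integrable majorant.\<close>
      have "(norm (x - y))\<^sup>2 + (norm (x + y))\<^sup>2 = 2 * (norm x)\<^sup>2 + 2 * (norm y)\<^sup>2"
        by (simp add: power2_norm_eq_inner inner_diff inner_add inner_commute)
      then show ?thesis
        by (smt (verit) zero_le_power2)
    qed
    then show "AE \<xi> in lebesgue_on {a..b}.
        norm ((norm (f \<xi> - g \<xi>))\<^sup>2) \<le> norm (2 * (norm (f \<xi>))\<^sup>2 + 2 * (norm (g \<xi>))\<^sup>2)"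
      by simp
  qed (use assms in \<open>auto simp: L2_def\<close>)
  then show ?thesis
    using assms by (auto simp: L2_def vec_over_def)
qed

lemma L2_part:
  assumes Q: "Q \<in> {real_part, imag_part}" and f: "f \<in> L2 UNIV a b"
  shows "(\<lambda>\<xi>. Q (f \<xi>)) \<in> L2 \<real> a b"
proof -
  have f': "f \<in> borel_measurable (lebesgue_on {a..b})"
    "integrable (lebesgue_on {a..b}) (\<lambda>\<xi>. (norm (f \<xi>))\<^sup>2)"
    using f by (auto simp: L2_def)
  have meas: "(\<lambda>\<xi>. Q (f \<xi>)) \<in> borel_measurable (lebesgue_on {a..b})"
    by (rule borel_measurable_continuous_on[OF linear_continuous_on f'(1)])
      (rule bounded_linear_part[OF Q])
  moreover have "integrable (lebesgue_on {a..b}) (\<lambda>\<xi>. (norm (Q (f \<xi>)))\<^sup>2)"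
    using f'(2)
  proof (rule Bochner_Integration.integrable_bound)
    show "AE \<xi> in lebesgue_on {a..b}. norm ((norm (Q (f \<xi>)))\<^sup>2) \<le> norm ((norm (f \<xi>))\<^sup>2)"
      by (simp add: power_mono norm_part_le[OF Q])
  qed (use meas in auto)
  ultimately show ?thesis
    by (simp add: L2_def part_in_vec_over[OF Q])
qed

text \<open>Real coefficients commute with \<open>Q\<close>, so a complex solution splits into two
  solutions over \<open>\<real>\<close>. This connects complex stationary solutions with the
  complexified operator.\<close>

lemma hbcs_rel_part:
  assumes Q: "Q \<in> {real_part, imag_part}"
    and P1: "P1 \<in> mat_over \<real>" and P0: "P0 \<in> Linf_mat \<real> a b" and H: "H \<in> Linf_mat \<real> a b"
    and rel: "hbcs_rel UNIV a b P1 P0 H x w z"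
  shows "hbcs_rel \<real> a b P1 P0 H (\<lambda>\<xi>. Q (x \<xi>)) (\<lambda>\<xi>. Q (w \<xi>)) (\<lambda>\<xi>. Q (z \<xi>))"
proof -
  obtain g where g: "has_H1_deriv UNIV a b w g"
    "AE \<xi> in lebesgue_on {a..b}. w \<xi> = H \<xi> *v x \<xi>"
    "AE \<xi> in lebesgue_on {a..b}. z \<xi> = P1 *v g \<xi> + P0 \<xi> *v (H \<xi> *v x \<xi>)"
    and xz: "x \<in> L2 UNIV a b" "z \<in> L2 UNIV a b"
    using rel by (auto simp: hbcs_rel_def)
  have mult: "Q (M *v v) = M *v Q v" if "M \<in> mat_over \<real>" for M v
    using Q that real_part_matrix_vector_mult imag_part_matrix_vector_mult by auto
  have add: "Q (u + v) = Q u + Q v" for u v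
    by (rule linear_add[OF bounded_linear.linear[OF bounded_linear_part[OF Q]]])
  have real: "AE \<xi> in lebesgue_on {a..b}. H \<xi> \<in> mat_over \<real>"
    "AE \<xi> in lebesgue_on {a..b}. P0 \<xi> \<in> mat_over \<real>"
    using P0 H by (auto simp: Linf_mat_def)
  have "has_H1_deriv \<real> a b (\<lambda>\<xi>. Q (w \<xi>)) (\<lambda>\<xi>. Q (g \<xi>))"
    using g(1) by (auto simp: has_H1_deriv_def intro: L2_part[OF Q]
        has_ac_deriv_linear[OF _ bounded_linear_part[OF Q]])
  moreover have "AE \<xi> in lebesgue_on {a..b}. Q (w \<xi>) = H \<xi> *v Q (x \<xi>)"
    using g(2) real(1) by eventually_elim (simp add: mult)
  moreover have "AE \<xi> in lebesgue_on {a..b}.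
      Q (z \<xi>) = P1 *v Q (g \<xi>) + P0 \<xi> *v (H \<xi> *v Q (x \<xi>))"
    using g(3) real by eventually_elim (simp add: mult add P1)
  ultimately show ?thesis
    using L2_part[OF Q] xz by (auto simp: hbcs_rel_def)
qed

section \<open>Passage to complex scalars\<close>

lemma Linf_mat_UNIV: "F \<in> Linf_mat K a b \<Longrightarrow> F \<in> Linf_mat UNIV a b"
  by (auto simp: Linf_mat_def mat_over_def)

text \<open>For \<open>K = \<real>\<close> the Loewner bound tests real vectors alone. Applying it
  to both parts of \<open>v\<close> and adding the results extends it to complex
  \<open>v\<close>.\<close>

lemma hbcs_coercive:
  assumes "hbcs K a b P1 P0 H WB WC"
  obtains m where "m > 0"
    "AE \<xi> in lebesgue_on {a..b}. \<forall>v. m * (norm v)\<^sup>2 \<le> v \<bullet> (H \<xi> *v v)"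
proof -
  obtain m where m: "m > 0"
    "AE \<xi> in lebesgue_on {a..b}. loewner_le K (mat (complex_of_real m)) (H \<xi>)"
    using assms unfolding hbcs_def by auto
  have K: "K = \<real> \<or> K = UNIV" and H: "AE \<xi> in lebesgue_on {a..b}. H \<xi> \<in> mat_over K"
    using assms by (auto simp: hbcs_def Linf_mat_def)
  have on_K: "m * (norm v)\<^sup>2 \<le> v \<bullet> (A *v v)"
    if "loewner_le K (mat (complex_of_real m)) A" "v \<in> vec_over K" for A :: "complex ^ 'a ^ 'a" and v
  proof -
    have "v \<bullet> (mat (complex_of_real m) *v v) = m * (norm v)\<^sup>2"
      unfolding mat_scalar_vector_mult power2_norm_eq_inner
      by (simp add: inner_vec_def inner_complex_def sum_distrib_left algebra_simps)
    moreover have "0 \<le> v \<bullet> ((A - mat (complex_of_real m)) *v v)"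
      using that by (simp add: loewner_le_def Re_cdot)
    ultimately show ?thesis
      by (simp add: matrix_vector_mult_diff_rdistrib inner_diff_right)
  qed
  have "AE \<xi> in lebesgue_on {a..b}. \<forall>v. m * (norm v)\<^sup>2 \<le> v \<bullet> (H \<xi> *v v)"
    using m(2) H
  proof eventually_elim
    case (elim \<xi>)
    show ?case
    proof
      fix v
      show "m * (norm v)\<^sup>2 \<le> v \<bullet> (H \<xi> *v v)"
      proof (cases "K = \<real>")
        case True
        then show ?thesis
          using on_K[OF elim(1), of "real_part v"] on_K[OF elim(1), of "imag_part v"] elim(2)
            norm_real_imag[of v] inner_real_imag[of "H \<xi>" v]
          by (simp add: part_in_vec_over algebra_simps)
      next
        case False
        then show ?thesis
          using on_K[OF elim(1), of v] K by (simp add: vec_over_def)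
      qed
    qed
  qed
  then show ?thesis
    using that m(1) by blast
qed

section \<open>The stationary equation\<close>

text \<open>Conjugation in the first argument is linear over the reals, which is the bilinearity
  meant here.\<close>

lemma bounded_bilinear_cdot: "bounded_bilinear (cdot :: complex ^ 'n \<Rightarrow> complex ^ 'n \<Rightarrow> complex)"
proof -
  have "bilinear (cdot :: complex ^ 'n \<Rightarrow> complex ^ 'n \<Rightarrow> complex)"
    unfolding bilinear_def
    by (auto intro!: linearI simp: cdot_def algebra_simps sum.distrib scaleR_right.sum)
  then show ?thesis
    by (simp add: bilinear_conv_bounded_bilinear)
qed

text \<open>The quantifier over \<open>v\<close> stands inside the \<open>AE\<close>: one null set
  serves all vectors, so the bound may be used at a vector depending on the point.\<close>

lemma Linf_mat_vector_bound:
  fixes F :: "real \<Rightarrow> complex ^ 'n ^ 'n"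
  assumes "F \<in> Linf_mat UNIV a b"
  obtains C where "C \<ge> 0"
    "AE \<xi> in lebesgue_on {a..b}. \<forall>v. norm (F \<xi> *v v) \<le> C * norm v"
proof -
  obtain B where B: "B \<ge> 0"
    "\<And>(M :: complex ^ 'n ^ 'n) v. norm (M *v v) \<le> norm M * norm v * B"
    using bounded_bilinear.nonneg_bounded[OF bounded_bilinear_matrix_vector_mult] by blast
  obtain C where C: "AE \<xi> in lebesgue_on {a..b}. norm (F \<xi>) \<le> C"
    using assms by (auto simp: Linf_mat_def)
  have "AE \<xi> in lebesgue_on {a..b}. \<forall>v. norm (F \<xi> *v v) \<le> (\<bar>C\<bar> * B) * norm v"
    using C
  proof eventually_elim
    case (elim \<xi>)
    show ?case
    proof
      fix v :: "complex ^ 'n"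
      have "norm (F \<xi>) * norm v * B \<le> \<bar>C\<bar> * norm v * B"
        using elim B(1) by (intro mult_right_mono) auto
      then show "norm (F \<xi> *v v) \<le> (\<bar>C\<bar> * B) * norm v"
        using B(2)[of "F \<xi>" v] by (simp add: ac_simps)
    qed
  qed
  then show ?thesis
    using that[of "\<bar>C\<bar> * B"] B(1) by simp
qed

text \<open>The setting of the differential equation over the complex numbers, common to both
  choices of \<open>K\<close>; coercivity is assumed on all complex vectors.\<close>

locale coercive_hbcs =
  fixes a b :: real and P1 :: "complex ^ 'n ^ 'n" and P0 H :: "real \<Rightarrow> complex ^ 'n ^ 'n"
    and m :: real
  assumes a_less_b: "a < b"
    and P1: "invertible P1"
    and P0: "P0 \<in> Linf_mat UNIV a b"
    and H: "H \<in> Linf_mat UNIV a b"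
    and m_pos: "m > 0"
    and coercive: "AE \<xi> in lebesgue_on {a..b}. \<forall>v. m * (norm v)\<^sup>2 \<le> v \<bullet> (H \<xi> *v v)"
begin

lemma H_inverse_AE:
  "AE \<xi> in lebesgue_on {a..b}.
     invertible (H \<xi>) \<and> (\<forall>v. norm (matrix_inv (H \<xi>) *v v) \<le> norm v / m)"
  using coercive by eventually_elim (auto intro: coercive_matrix_invertible m_pos)

section \<open>The norm of the state space and eigenfunctions\<close>

lemma H_measurable: "H \<in> borel_measurable (lebesgue_on {a..b})"
  using H by (auto simp: Linf_mat_def)

text \<open>The majorant \<open>C * B * (norm (f \<xi>))\<^sup>2\<close> makes the complex integrand
  integrable, which permits moving \<open>Re\<close> inside the integral.\<close>

lemma norm_X_eq:
  assumes f: "f \<in> L2 UNIV a b"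
  shows "integrable (lebesgue_on {a..b}) (\<lambda>\<xi>. f \<xi> \<bullet> (H \<xi> *v f \<xi>))"
    and "norm_X a b H f = sqrt (1 / 2 * (LINT \<xi>|lebesgue_on {a..b}. f \<xi> \<bullet> (H \<xi> *v f \<xi>)))"
proof -
  have f': "f \<in> borel_measurable (lebesgue_on {a..b})"
    "integrable (lebesgue_on {a..b}) (\<lambda>\<xi>. (norm (f \<xi>))\<^sup>2)"
    using f by (auto simp: L2_def)
  obtain B where B: "B \<ge> 0"
    "\<And>v w :: complex ^ 'n. norm (cdot v w) \<le> norm v * norm w * B"
    using bounded_bilinear.nonneg_bounded[OF bounded_bilinear_cdot] by blast
  obtain C where C: "C \<ge> 0" "AE \<xi> in lebesgue_on {a..b}. \<forall>v. norm (H \<xi> *v v) \<le> C * norm v"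
    using Linf_mat_vector_bound[OF H] by blast
  have int: "integrable (lebesgue_on {a..b}) (\<lambda>\<xi>. cdot (f \<xi>) (H \<xi> *v f \<xi>))"
  proof (rule Bochner_Integration.integrable_bound)
    show "integrable (lebesgue_on {a..b}) (\<lambda>\<xi>. C * B * (norm (f \<xi>))\<^sup>2)"
      using f'(2) by simp
    show "(\<lambda>\<xi>. cdot (f \<xi>) (H \<xi> *v f \<xi>)) \<in> borel_measurable (lebesgue_on {a..b})"
      by (rule borel_measurable_continuous_Pair[OF f'(1)
            borel_measurable_matrix_vector_mult[OF H_measurable f'(1)]])
        (intro bounded_bilinear.continuous_on[OF bounded_bilinear_cdot] continuous_intros)
    show "AE \<xi> in lebesgue_on {a..b}.
        norm (cdot (f \<xi>) (H \<xi> *v f \<xi>)) \<le> norm (C * B * (norm (f \<xi>))\<^sup>2)"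
      using C(2)
    proof eventually_elim
      case (elim \<xi>)
      have "norm (cdot (f \<xi>) (H \<xi> *v f \<xi>)) \<le> norm (f \<xi>) * norm (H \<xi> *v f \<xi>) * B"
        by (rule B(2))
      also have "\<dots> \<le> norm (f \<xi>) * (C * norm (f \<xi>)) * B"
        using elim B(1) by (intro mult_right_mono mult_left_mono) auto
      finally show ?case
        using B(1) C(1) by (simp add: power2_eq_square ac_simps)
    qed
  qed
  show "integrable (lebesgue_on {a..b}) (\<lambda>\<xi>. f \<xi> \<bullet> (H \<xi> *v f \<xi>))"
    using integrable_Re[OF int] by (simp add: Re_cdot)
  show "norm_X a b H f = sqrt (1 / 2 * (LINT \<xi>|lebesgue_on {a..b}. f \<xi> \<bullet> (H \<xi> *v f \<xi>)))"
    using integral_Re[OF int] by (simp add: norm_X_def inner_X_def Re_cdot)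
qed

lemma inner_H_nonneg_AE: "AE \<xi> in lebesgue_on {a..b}. 0 \<le> f \<xi> \<bullet> (H \<xi> *v f \<xi>)"
  using coercive
proof eventually_elim
  case (elim \<xi>)
  have "0 \<le> m * (norm (f \<xi>))\<^sup>2"
    using m_pos by simp
  then show ?case
    using elim order_trans by blast
qed

lemma norm_X_nonneg:
  assumes "f \<in> L2 UNIV a b"
  shows "norm_X a b H f \<ge> 0"
  unfolding norm_X_eq(2)[OF assms] using inner_H_nonneg_AE[of f] by (simp add: integral_nonneg_AE)

text \<open>A nonnegative integrand with integral 0 vanishes almost everywhere, and coercivity
  passes this on to \<open>f\<close>. Thus distance zero in the state space means equality almost
  everywhere.\<close>

lemma norm_X_eq_0_imp_AE:
  assumes f: "f \<in> L2 UNIV a b" and "norm_X a b H f = 0"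
  shows "AE \<xi> in lebesgue_on {a..b}. f \<xi> = 0"
proof -
  have "(LINT \<xi>|lebesgue_on {a..b}. f \<xi> \<bullet> (H \<xi> *v f \<xi>)) = 0"
    using assms(2) by (simp add: norm_X_eq(2)[OF f])
  then have "AE \<xi> in lebesgue_on {a..b}. f \<xi> \<bullet> (H \<xi> *v f \<xi>) = 0"
    using integral_nonneg_eq_0_iff_AE[OF norm_X_eq(1)[OF f] inner_H_nonneg_AE] by simp
  then show ?thesis
    using coercive
  proof eventually_elim
    case (elim \<xi>)
    then have "m * (norm (f \<xi>))\<^sup>2 \<le> 0"
      by metis
    then show ?case
      using m_pos by (simp add: mult_le_0_iff)
  qed
qed

text \<open>For an eigenpair the residual \<open>s *s x \<eta> - z \<eta>\<close> is the zero
  function, so \<open>R\<close> of zero represents \<open>x\<close>. The operator bound shows that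
  \<open>R\<close> of zero has norm 0.\<close>

lemma eigenfunction_AE_0:
  assumes s: "s \<in> resolvent_set (L2 UNIV a b) (norm_X a b H) A"
    and eigen: "(x, \<lambda>\<xi>. s *s x \<xi>) \<in> A" and x: "x \<in> L2 UNIV a b"
  shows "AE \<xi> in lebesgue_on {a..b}. x \<xi> = 0"
proof -
  obtain R where R: "bounded_op UNIV (L2 UNIV a b) (norm_X a b H) R"
    "\<forall>(x, z)\<in>A. norm_X a b H (\<lambda>\<xi>. R (\<lambda>\<eta>. s *s x \<eta> - z \<eta>) \<xi> - x \<xi>) = 0"
    using s by (auto simp: resolvent_set_def)
  define r where "r = R (\<lambda>_. 0)"
  have zero: "(\<lambda>_. 0) \<in> L2 UNIV a b"
    by (rule continuous_on_in_L2) simp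
  then have r: "r \<in> L2 UNIV a b"
    using R(1) unfolding bounded_op_def r_def by blast
  have "norm_X a b H (\<lambda>_. 0) = 0"
    by (simp add: norm_X_eq(2)[OF zero])
  then have "norm_X a b H r \<le> 0"
    using R(1) zero unfolding bounded_op_def r_def by (metis mult_zero_right)
  then have "AE \<xi> in lebesgue_on {a..b}. r \<xi> = 0"
    using norm_X_nonneg[OF r] by (intro norm_X_eq_0_imp_AE[OF r]) simp
  moreover have "norm_X a b H (\<lambda>\<xi>. r \<xi> - x \<xi>) = 0"
    using bspec[OF R(2) eigen] by (simp add: r_def)
  then have "AE \<xi> in lebesgue_on {a..b}. r \<xi> - x \<xi> = 0"
    by (intro norm_X_eq_0_imp_AE L2_diff r x)
  ultimately show ?thesis
    by eventually_elim simp
qed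

section \<open>The linear differential equation for \<open>w = H x\<close>\<close>

definition coefficient :: "complex \<Rightarrow> real \<Rightarrow> complex ^ 'n \<Rightarrow> complex ^ 'n" where
  "coefficient s \<xi> v =
     - (matrix_inv P1 *v (P0 \<xi> *v v - s *s (matrix_inv (H \<xi>) *v v)))"

lemma coefficient_diff: "coefficient s \<xi> (v - w) = coefficient s \<xi> v - coefficient s \<xi> w"
  by (simp add: coefficient_def matrix_vector_mult_diff_distrib algebra_simps
      flip: mat_scalar_vector_mult)

lemma coefficient_bound:
  obtains L where "L > 0"
    "AE \<xi> in lebesgue_on {a..b}. \<forall>v. norm (coefficient s \<xi> v) \<le> L * norm v"
proof -
  obtain B where B: "B > 0"
    "\<And>v. norm (matrix_inv P1 *v v) \<le> norm v * B"
    using bounded_linear.pos_bounded[OF matrix_vector_mul_bounded_linear[of "matrix_inv P1"]]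
    by blast
  obtain S where S: "S > 0" "\<And>v :: complex ^ 'n. norm (s *s v) \<le> norm v * S"
    using bounded_linear.pos_bounded[OF matrix_vector_mul_bounded_linear[of "mat s"]]
    unfolding mat_scalar_vector_mult by blast
  obtain C where C: "C \<ge> 0" "AE \<xi> in lebesgue_on {a..b}. \<forall>v. norm (P0 \<xi> *v v) \<le> C * norm v"
    using Linf_mat_vector_bound[OF P0] by blast
  \<comment> \<open>\<open>C\<close> bounds \<open>P0\<close>, \<open>S\<close> bounds scaling by
    \<open>s\<close>, \<open>1 / m\<close> bounds the inverse of \<open>H\<close>, and
    \<open>B\<close> bounds the inverse of \<open>P1\<close>.\<close>
  define L where "L = (C + S / m) * B"
  have "AE \<xi> in lebesgue_on {a..b}. \<forall>v. norm (coefficient s \<xi> v) \<le> L * norm v"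
    using C(2) H_inverse_AE
  proof eventually_elim
    case (elim \<xi>)
    show ?case
    proof
      fix v
      have "norm (s *s (matrix_inv (H \<xi>) *v v)) \<le> norm (matrix_inv (H \<xi>) *v v) * S"
        by (rule S(2))
      also have "\<dots> \<le> norm v / m * S"
        using elim(2) S(1) by (intro mult_right_mono) auto
      finally have "norm (P0 \<xi> *v v - s *s (matrix_inv (H \<xi>) *v v)) \<le> C * norm v + norm v / m * S"
        using elim(1) by (intro norm_triangle_le_diff) (simp add: add_mono)
      then have "norm (coefficient s \<xi> v) \<le> (C * norm v + norm v / m * S) * B"
        unfolding coefficient_def norm_minus_cancel
        by (intro order_trans[OF B(2)] mult_right_mono) (use B(1) in auto)
      then show "norm (coefficient s \<xi> v) \<le> L * norm v"
        by (simp add: L_def algebra_simps)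
    qed
  qed
  moreover have "L > 0"
    unfolding L_def using B(1) C(1) S(1) m_pos by (intro mult_pos_pos add_nonneg_pos) auto
  ultimately show ?thesis
    using that by blast
qed

text \<open>Substitute \<open>matrix_inv (H \<xi>) *v w \<xi>\<close> for \<open>x \<xi>\<close> in
  the stationary equation and solve for the derivative of \<open>w\<close>. The last clause allows
  uniqueness of \<open>w\<close> to be carried over to \<open>x\<close>.\<close>

lemma stationary_deriv:
  assumes "hbcs_rel UNIV a b P1 P0 H x w (\<lambda>\<xi>. s *s x \<xi>)"
  obtains g where "has_ac_deriv a b w g"
    "AE \<xi> in lebesgue_on {a..b}. g \<xi> = coefficient s \<xi> (w \<xi>)"
    "AE \<xi> in lebesgue_on {a..b}. x \<xi> = matrix_inv (H \<xi>) *v w \<xi>"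
proof -
  obtain g where g: "has_ac_deriv a b w g"
    "AE \<xi> in lebesgue_on {a..b}. w \<xi> = H \<xi> *v x \<xi>"
    "AE \<xi> in lebesgue_on {a..b}. s *s x \<xi> = P1 *v g \<xi> + P0 \<xi> *v (H \<xi> *v x \<xi>)"
    using assms by (auto simp: hbcs_rel_def has_H1_deriv_def)
  have x: "AE \<xi> in lebesgue_on {a..b}. x \<xi> = matrix_inv (H \<xi>) *v w \<xi>"
    using g(2) H_inverse_AE by eventually_elim (simp add: matrix_inv_vector_mult)
  have "AE \<xi> in lebesgue_on {a..b}. g \<xi> = coefficient s \<xi> (w \<xi>)"
    using g(2,3) x
  proof eventually_elim
    case (elim \<xi>)
    have "P0 \<xi> *v w \<xi> - s *s (matrix_inv (H \<xi>) *v w \<xi>) = - (P1 *v g \<xi>)"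
      unfolding elim(3)[symmetric] elim(2) by (simp add: elim(1))
    then have "coefficient s \<xi> (w \<xi>) = matrix_inv P1 *v (P1 *v g \<xi>)"
      \<comment> \<open>The difference rule with minuend 0 moves the sign through the
        matrix.\<close>
      using matrix_vector_mult_diff_distrib[of "matrix_inv P1" 0] by (simp add: coefficient_def)
    then show ?case
      by (simp add: matrix_inv_vector_mult[OF P1])
  qed
  with g(1) x show ?thesis
    using that by blast
qed

lemma fundamental_solution_deriv:
  assumes "fundamental_solution a b P1 P0 H s \<Psi>"
  obtains g where "has_ac_deriv a b (\<lambda>\<xi>. \<Psi> \<xi> *v v) g"
    "AE \<xi> in lebesgue_on {a..b}. g \<xi> = coefficient s \<xi> (\<Psi> \<xi> *v v)"
proof -
  obtain D where D: "has_ac_deriv a b \<Psi> D"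
    "AE \<zeta> in lebesgue_on {a..b}.
       D \<zeta> = - (matrix_inv P1 ** (P0 \<zeta> - mat s ** matrix_inv (H \<zeta>))) ** \<Psi> \<zeta>"
    using assms by (auto simp: fundamental_solution_def)
  have "AE \<xi> in lebesgue_on {a..b}. D \<xi> *v v = coefficient s \<xi> (\<Psi> \<xi> *v v)"
    using D(2)
  proof eventually_elim
    case (elim \<xi>)
    have "(- M) *v u = - (M *v u)" for M :: "complex ^ 'n ^ 'n" and u
      using matrix_vector_mult_diff_rdistrib[of 0 M u] by simp
    then show ?case
      unfolding elim coefficient_def
      by (simp add: matrix_vector_mult_diff_rdistrib
          flip: matrix_vector_mul_assoc mat_scalar_vector_mult)
  qed
  then show ?thesis
    using that has_ac_deriv_linear[OF D(1)
        bounded_bilinear.bounded_linear_left[OF bounded_bilinear_matrix_vector_mult]]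
    by blast
qed

text \<open>Every initial vector yields a stationary solution. \<open>\<Psi> \<xi> *v v\<close> is
  continuous, hence bounded; the bounds on the inverse of \<open>H\<close> and on
  \<open>coefficient\<close> make the state and the derivative bounded too, so all of them lie in
  \<open>L2\<close>.\<close>

lemma fundamental_solution_stationary:
  assumes \<Psi>: "fundamental_solution a b P1 P0 H s \<Psi>"
  shows "hbcs_rel UNIV a b P1 P0 H (\<lambda>\<xi>. matrix_inv (H \<xi>) *v (\<Psi> \<xi> *v v)) (\<lambda>\<xi>. \<Psi> \<xi> *v v)
    (\<lambda>\<xi>. s *s (matrix_inv (H \<xi>) *v (\<Psi> \<xi> *v v)))"
proof -
  define w where "w \<xi> = \<Psi> \<xi> *v v" for \<xi>
  define x where "x \<xi> = matrix_inv (H \<xi>) *v w \<xi>" for \<xi>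
  obtain g where g: "has_ac_deriv a b w g"
    "AE \<xi> in lebesgue_on {a..b}. g \<xi> = coefficient s \<xi> (w \<xi>)"
    using fundamental_solution_deriv[OF \<Psi>] unfolding w_def by blast
  have cont: "continuous_on {a..b} w"
    by (rule has_ac_deriv_continuous_on[OF g(1)])
  then have w_meas: "w \<in> borel_measurable (lebesgue_on {a..b})"
    by (rule continuous_imp_measurable_on_sets_lebesgue) simp
  have "bounded (w ` {a..b})"
    using cont by (intro compact_imp_bounded compact_continuous_image) auto
  then obtain C where "\<And>\<xi>. \<xi> \<in> {a..b} \<Longrightarrow> norm (w \<xi>) \<le> C"
    by (force simp: bounded_iff)
  then have C: "AE \<xi> in lebesgue_on {a..b}. norm (w \<xi>) \<le> C"
    by (intro AE_I2) auto
  have x_meas: "x \<in> borel_measurable (lebesgue_on {a..b})"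
    unfolding x_def
    by (intro borel_measurable_matrix_vector_mult borel_measurable_matrix_inv H_measurable w_meas)
  have x_bound: "AE \<xi> in lebesgue_on {a..b}. norm (x \<xi>) \<le> C / m"
    using C H_inverse_AE
  proof eventually_elim
    case (elim \<xi>)
    then have "norm (x \<xi>) \<le> norm (w \<xi>) / m"
      by (simp add: x_def)
    also have "\<dots> \<le> C / m"
      using elim m_pos by (simp add: divide_right_mono)
    finally show ?case .
  qed
  have x: "x \<in> L2 UNIV a b"
    using x_meas x_bound by (rule bounded_measurable_in_L2)
  obtain S where S: "S > 0" "\<And>v :: complex ^ 'n. norm (s *s v) \<le> norm v * S"
    using bounded_linear.pos_bounded[OF matrix_vector_mul_bounded_linear[of "mat s"]]
    unfolding mat_scalar_vector_mult by blast
  have sx: "(\<lambda>\<xi>. s *s x \<xi>) \<in> L2 UNIV a b"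
  proof (rule bounded_measurable_in_L2)
    show "(\<lambda>\<xi>. s *s x \<xi>) \<in> borel_measurable (lebesgue_on {a..b})"
      unfolding mat_scalar_vector_mult[symmetric]
      by (intro borel_measurable_matrix_vector_mult x_meas) simp
    show "AE \<xi> in lebesgue_on {a..b}. norm (s *s x \<xi>) \<le> C / m * S"
      using x_bound
    proof eventually_elim
      case (elim \<xi>)
      then have "norm (x \<xi>) * S \<le> C / m * S"
        using S(1) by (intro mult_right_mono) auto
      then show ?case
        using S(2)[of "x \<xi>"] by linarith
    qed
  qed
  obtain L where L: "L > 0"
    "AE \<xi> in lebesgue_on {a..b}. \<forall>v. norm (coefficient s \<xi> v) \<le> L * norm v"
    using coefficient_bound by blast
  have "g \<in> L2 UNIV a b"
  proof (rule bounded_measurable_in_L2)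
    show "g \<in> borel_measurable (lebesgue_on {a..b})"
      using g(1) by (simp add: has_ac_deriv_def absolutely_integrable_measurable)
    show "AE \<xi> in lebesgue_on {a..b}. norm (g \<xi>) \<le> L * C"
      using g(2) L(2) C
    proof eventually_elim
      case (elim \<xi>)
      then have "norm (g \<xi>) \<le> L * norm (w \<xi>)"
        by simp
      also have "\<dots> \<le> L * C"
        using elim L(1) by simp
      finally show ?case .
    qed
  qed
  then have "has_H1_deriv UNIV a b w g"
    using g(1) continuous_on_in_L2[OF cont] by (simp add: has_H1_deriv_def)
  moreover have wx: "AE \<xi> in lebesgue_on {a..b}. w \<xi> = H \<xi> *v x \<xi>"
    using H_inverse_AE by eventually_elim (simp add: x_def matrix_inv_vector_mult)
  moreover have "AE \<xi> in lebesgue_on {a..b}. s *s x \<xi> = P1 *v g \<xi> + P0 \<xi> *v (H \<xi> *v x \<xi>)"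
    using g(2) wx
  proof eventually_elim
    case (elim \<xi>)
    have "P1 *v g \<xi> = - (P0 \<xi> *v w \<xi> - s *s x \<xi>)"
      using matrix_vector_mult_diff_distrib[of P1 0]
      by (simp add: elim(1) coefficient_def x_def matrix_inv_vector_mult[OF P1])
    then show ?case
      by (simp flip: elim(2))
  qed
  ultimately show ?thesis
    using x sx unfolding hbcs_rel_def x_def w_def by blast
qed

text \<open>The difference of both sides is 0 at \<open>a\<close>, and by linearity of
  \<open>coefficient\<close> its derivative is bounded by \<open>L\<close> times its norm, so
  Gronwall's lemma applies.\<close>

lemma stationary_eq_fundamental_solution:
  assumes \<Psi>: "fundamental_solution a b P1 P0 H s \<Psi>"
    and rel: "hbcs_rel UNIV a b P1 P0 H x w (\<lambda>\<xi>. s *s x \<xi>)"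
    and \<xi>: "\<xi> \<in> {a..b}"
  shows "w \<xi> = \<Psi> \<xi> *v w a"
proof -
  obtain g where g: "has_ac_deriv a b w g"
    "AE \<xi> in lebesgue_on {a..b}. g \<xi> = coefficient s \<xi> (w \<xi>)"
    using stationary_deriv[OF rel] by blast
  obtain h where h: "has_ac_deriv a b (\<lambda>\<xi>. \<Psi> \<xi> *v w a) h"
    "AE \<xi> in lebesgue_on {a..b}. h \<xi> = coefficient s \<xi> (\<Psi> \<xi> *v w a)"
    using fundamental_solution_deriv[OF \<Psi>] by blast
  obtain L where L: "L > 0"
    "AE \<xi> in lebesgue_on {a..b}. \<forall>v. norm (coefficient s \<xi> v) \<le> L * norm v"
    using coefficient_bound by blast
  have "w \<xi> - \<Psi> \<xi> *v w a = 0"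
  proof (rule has_ac_deriv_eq_0[OF has_ac_deriv_diff[OF g(1) h(1)] _ L(1) _ \<xi>])
    show "w a - \<Psi> a *v w a = 0"
      using \<Psi> by (simp add: fundamental_solution_def)
    show "AE \<xi> in lebesgue_on {a..b}. norm (g \<xi> - h \<xi>) \<le> L * norm (w \<xi> - \<Psi> \<xi> *v w a)"
      using g(2) h(2) L(2) by eventually_elim (simp flip: coefficient_diff)
  qed
  then show ?thesis
    by simp
qed

end

text \<open>For \<open>K = \<real>\<close> the resolvent set refers to the complexification, so the
  complex pair must be exhibited as a combination of two pairs from the real operator, namely its
  parts.\<close>

lemma stationary_in_hbcs_operator:
  assumes hbcs: "hbcs K a b P1 P0 H WB WC"
    and rel: "hbcs_rel UNIV a b P1 P0 H x w z" and 0: "WB *v stack (w b) (w a) = 0"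
  shows "(x, z) \<in> (if K = \<real> then complexification (hbcs_operator K a b P1 P0 H WB)
     else hbcs_operator K a b P1 P0 H WB)"
proof (cases "K = \<real>")
  case True
  have real: "P1 \<in> mat_over \<real>" "P0 \<in> Linf_mat \<real> a b" "H \<in> Linf_mat \<real> a b" "WB \<in> mat_over \<real>"
    using hbcs True by (auto simp: hbcs_def)
  have "(\<lambda>\<xi>. Q (x \<xi>), \<lambda>\<xi>. Q (z \<xi>)) \<in> hbcs_operator \<real> a b P1 P0 H WB"
    if "Q \<in> {real_part, imag_part}" for Q
    using hbcs_rel_part[OF that real(1-3) rel] part_boundary_kernel[OF that real(4) 0]
    unfolding hbcs_operator_def by auto
  from this[of real_part, simplified] this[of imag_part, simplified]
  have "(\<lambda>\<xi>. real_part (x \<xi>) + \<i> *s imag_part (x \<xi>), \<lambda>\<xi>. real_part (z \<xi>) + \<i> *s imag_part (z \<xi>))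
      \<in> complexification (hbcs_operator \<real> a b P1 P0 H WB)"
    unfolding complexification_def mem_Collect_eq by (intro exI conjI) (rule refl)
  then show ?thesis
    using True by (simp flip: real_imag_decomposition)
next
  case False
  then have "K = UNIV"
    using hbcs by (simp add: hbcs_def)
  then show ?thesis
    using False rel 0 by (auto simp: hbcs_operator_def)
qed

text \<open>\<open>matrix_inv\<close> and \<open>THE\<close> are total, so invertibility and unique
  existence are asserted together with the formula to give both sides their intended
  meaning.\<close>

theorem proposition8:
  fixes K :: "complex set" and a b :: real
    and P1 :: "complex ^ 'n ^ 'n" and P0 H :: "real \<Rightarrow> complex ^ 'n ^ 'n"
    and WB WC :: "complex ^ ('n + 'n) ^ 'n"
    and s :: complex and \<Psi> :: "real \<Rightarrow> complex ^ 'n ^ 'n"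
  assumes "hbcs K a b P1 P0 H WB WC"
    and "s \<in> hbcs_resolvent_set K a b P1 P0 H WB"
    and "fundamental_solution a b P1 P0 H s \<Psi>"
  shows "invertible (WB ** stack (\<Psi> b) (mat 1)) \<and>
    (\<exists>!G. is_transfer_matrix a b P1 P0 H WB WC s G) \<and>
    transfer_function a b P1 P0 H WB WC s =
      WC ** stack (\<Psi> b) (mat 1) ** matrix_inv (WB ** stack (\<Psi> b) (mat 1))"
proof -
  note \<Psi> = assms(3)
  obtain m where "m > 0" "AE \<xi> in lebesgue_on {a..b}. \<forall>v. m * (norm v)\<^sup>2 \<le> v \<bullet> (H \<xi> *v v)"
    using hbcs_coercive[OF assms(1)] by blast
  then interpret coercive_hbcs a b P1 P0 H m
    using assms(1) by unfold_locales (auto simp: hbcs_def intro: Linf_mat_UNIV)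
  define x where "x v \<xi> = matrix_inv (H \<xi>) *v (\<Psi> \<xi> *v v)" for v \<xi>
  have rel: "hbcs_rel UNIV a b P1 P0 H (x v) (\<lambda>\<xi>. \<Psi> \<xi> *v v) (\<lambda>\<xi>. s *s x v \<xi>)" for v
    unfolding x_def by (rule fundamental_solution_stationary[OF \<Psi>])
  have \<Psi>a: "\<Psi> a *v v = v" for v
    using \<Psi> by (simp add: fundamental_solution_def)
  define S where "S = stack (\<Psi> b) (mat 1)"
  have S: "S *v v = stack (\<Psi> b *v v) v" for v
    by (simp add: S_def stack_vector_mult)
  define W where "W = WB ** S"
  have W: "W *v v = WB *v stack (\<Psi> b *v v) v" for v
    by (simp add: W_def S flip: matrix_vector_mul_assoc)
  \<comment> \<open>A kernel vector of \<open>W\<close> makes \<open>x v\<close> an eigenfunction of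
    the operator for \<open>s\<close>, which the resolvent set excludes unless \<open>x v\<close>
    vanishes.\<close>
  have "v = 0" if "W *v v = 0" for v
  proof -
    have "x v \<in> L2 UNIV a b"
      using rel[of v] by (simp add: hbcs_rel_def)
    moreover have "WB *v stack (\<Psi> b *v v) (\<Psi> a *v v) = 0"
      using that by (simp add: W \<Psi>a)
    from stationary_in_hbcs_operator[OF assms(1) rel this]
    have "(x v, \<lambda>\<xi>. s *s x v \<xi>) \<in> (if K = \<real> then complexification (hbcs_operator K a b P1 P0 H WB)
        else hbcs_operator K a b P1 P0 H WB)" .
    ultimately have "AE \<xi> in lebesgue_on {a..b}. x v \<xi> = 0"
      using assms(2) unfolding hbcs_resolvent_set_def by (intro eigenfunction_AE_0)
    then have "AE \<xi> in lebesgue_on {a..b}. \<Psi> \<xi> *v v = 0"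
      using H_inverse_AE
    proof eventually_elim
      case (elim \<xi>)
      then show ?case
        using matrix_inv_vector_mult(1)[of "H \<xi>" "\<Psi> \<xi> *v v"] by (simp add: x_def)
    qed
    moreover have "continuous_on {a..b} (\<lambda>\<xi>. \<Psi> \<xi> *v v)"
      using fundamental_solution_deriv[OF \<Psi>] has_ac_deriv_continuous_on by metis
    ultimately have "\<Psi> a *v v = 0"
      by (intro continuous_on_AE_0_left_endpoint[OF a_less_b])
    then show ?thesis
      by (simp add: \<Psi>a)
  qed
  then have inv: "invertible W"
    by (simp add: invertible_left_inverse matrix_left_invertible_ker)
  \<comment> \<open>The value \<open>matrix_inv W *v u\<close> at \<open>a\<close> is the one that
    produces the input \<open>u\<close>, since \<open>W\<close> maps the value at \<open>a\<close>
    to the input.\<close>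
  have stationary: "hbcs_stationary a b P1 P0 H WB s u (x (matrix_inv W *v u))
      (\<lambda>\<xi>. \<Psi> \<xi> *v (matrix_inv W *v u))" for u
    using rel by (simp add: hbcs_stationary_def \<Psi>a matrix_inv_vector_mult[OF inv] flip: W)
  \<comment> \<open>Conversely the input forces the value at \<open>a\<close>, and with it
    \<open>w\<close> at every point of \<open>{a..b}\<close>, the endpoints included.\<close>
  have stationaryD: "w \<xi> = \<Psi> \<xi> *v (matrix_inv W *v u)"
    if st: "hbcs_stationary a b P1 P0 H WB s u y w" and "\<xi> \<in> {a..b}" for u y w \<xi>
  proof -
    have w: "w \<xi> = \<Psi> \<xi> *v w a" if "\<xi> \<in> {a..b}" for \<xi>
      using st that by (auto simp: hbcs_stationary_def intro: stationary_eq_fundamental_solution[OF \<Psi>])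
    have "u = W *v w a"
      using st w[of b] a_less_b by (simp add: hbcs_stationary_def W)
    then show ?thesis
      using w[OF \<open>\<xi> \<in> {a..b}\<close>] by (simp add: matrix_inv_vector_mult[OF inv])
  qed
  have x_unique: "AE \<xi> in lebesgue_on {a..b}. y \<xi> = x (matrix_inv W *v u) \<xi>"
    if st: "hbcs_stationary a b P1 P0 H WB s u y w" for u y w
  proof -
    have "AE \<xi> in lebesgue_on {a..b}. y \<xi> = matrix_inv (H \<xi>) *v w \<xi>"
      using st stationary_deriv unfolding hbcs_stationary_def by blast
    moreover have "AE \<xi> in lebesgue_on {a..b}. w \<xi> = \<Psi> \<xi> *v (matrix_inv W *v u)"
      by (rule AE_I2) (simp add: stationaryD[OF st])
    ultimately show ?thesis
      by eventually_elim (simp add: x_def)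
  qed
  define G where "G = WC ** S ** matrix_inv W"
  have G: "G *v u = WC *v stack (\<Psi> b *v (matrix_inv W *v u)) (matrix_inv W *v u)" for u
    by (simp add: G_def S flip: matrix_vector_mul_assoc)
  have "is_transfer_matrix a b P1 P0 H WB WC s G"
    unfolding is_transfer_matrix_def
  proof (intro allI exI conjI impI)
    show "hbcs_stationary a b P1 P0 H WB s u (x (matrix_inv W *v u))
        (\<lambda>\<xi>. \<Psi> \<xi> *v (matrix_inv W *v u))" for u
      by (rule stationary)
  qed (use x_unique in \<open>auto simp: G \<Psi>a\<close>)
  \<comment> \<open>The definition supplies some solution for each input. Its boundary values are
    those forced by \<open>stationaryD\<close>, so \<open>G'\<close> and \<open>G\<close> agree on
    every vector.\<close>
  moreover have "G' = G" if "is_transfer_matrix a b P1 P0 H WB WC s G'" for G'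
  proof -
    have "G' *v u = G *v u" for u
    proof -
      obtain y w where st: "hbcs_stationary a b P1 P0 H WB s u y w"
        and G': "G' *v u = WC *v stack (w b) (w a)"
        using \<open>is_transfer_matrix a b P1 P0 H WB WC s G'\<close> unfolding is_transfer_matrix_def by blast
      show ?thesis
        using stationaryD[OF st, of a] stationaryD[OF st, of b] a_less_b by (simp add: G G' \<Psi>a)
    qed
    then show ?thesis
      by (simp add: matrix_eq)
  qed
  ultimately have "\<exists>!G. is_transfer_matrix a b P1 P0 H WB WC s G"
    and "transfer_function a b P1 P0 H WB WC s = G"
    unfolding transfer_function_def by (blast, intro the_equality)
  then show ?thesis
    using inv by (simp add: G_def W_def S_def)
qed

end
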